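(* Let $G$ be a finite graph, let $Z_G(p,q)=\sum_{S}(-1)^{e(S)}(1+p)^{e(S)}(1+q)^{c(S)}$ be its dichromatic polynomial in the variables $v=1+p$, $\lambda=1+q$ (sum over all spanning subgraphs $S$ of $G$), and let $H^{k,i,j}(G)$ be the dichromatic homology groups of $G$. Then $$Z_{G}(p,q) =\sum_{i,j} p^{i}q^{j}\, \chi (H^{\star, i,j}(G)),$$ where $\chi(H^{\star,i,j}(G))=\sum_k(-1)^k\operatorname{rank}H^{k,i,j}(G)$.
   Context: $G$ is a finite graph (multiple edges and loops allowed). A subgraph $S$ of $G$ here always consists of all nodes of $G$ together with a subset of the edges of $G$; $e(S)$ is its number of edges and $c(S)$ its number of connected components. Dichromatic polynomial (with the sign convention used for the homology): $Z_G(v,\lambda)=\sum_S(-1)^{e(S)}v^{e(S)}\lambda^{c(S)}$, with $v=1+p$ and $\lambda=1+q$, so $Z_G(p,q)=\sum_{S}(-1)^{e(S)}(1+p)^{e(S)}(1+q)^{c(S)}$. Refined enhanced states: a refined enhanced state $s$ is a subgraph $S$ together with a labeling of each connected component of $S$ by $1$ or $x$, and an independent labeling of each edge of $S$ by $1$ or $y$. Component labels are regarded as elements of the ring $\mathbb{Z}[x]/(x^2)$; edge labels $1,y$ are merely formal markers. For such $s$, $e(s)$ is the number of edges, $i(s)$ the number of edges labeled $y$, and $j(s)$ the number of components labeled $x$. Dichromatic complex: $C^{k,i,j}(G)$ is the free abelian group on the refined enhanced states $s$ with $e(s)=k$, $i(s)=i$, $j(s)=j$. For an edge $e$ of $G$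 not in $s$, the partial differential $\partial_e(s)$ is the state obtained from $s$ by adding the edge $e$ with edge label $1$, keeping all other edge labels, and labeling components as follows: if the ends of $e$ lie in two different components of $s$ with labels $a,b$, the merged component gets label $ab\in\mathbb{Z}[x]/(x^2)$ (and $\partial_e(s)=0$ if $ab=0$, i.e. $a=b=x$); if the ends of $e$ lie in a single component with label $a$, that component keeps label $a$; all other components keep their labels. Fix an ordering of the edges of $G$ and let $d(s)=\sum_{e\in G-s}(-1)^{n(e)}\partial_e(s)$, the sum over edges $e$ of $G$ not in $s$, where $n(e)$ is the number of edges in $s$ that precede $e$. Then $d:C^{k,i,j}(G)\to C^{k+1,i,j}(G)$, $d^2=0$, and $H^{k,i,j}(G)$ denotes the kernel of $d$ on $C^{k,i,j}(G)$ modulo the image of $d$ from $C^{k-1,i,j}(G)$. *)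

theory Defs
  imports
    "HOL-Algebra.Coset"
    "HOL-Algebra.FiniteProduct"
    "HOL-Algebra.Free_Abelian_Groups"
    "HOL-Computational_Algebra.Polynomial"
    "HOL-Library.Uprod"
    "HOL-Library.Groups_Big_Fun"
begin

section \<open>Finite graphs with loops and multiple edges\<close>

text \<open>An edge is joined to the unordered pair of its ends; a loop has ends \<open>Upair v v\<close>, and
  distinct edges may have the same ends.\<close>

record ('v, 'e) multigraph =
  verts :: "'v set"
  edges :: "'e set"
  ends :: "'e \<Rightarrow> 'v uprod"

definition finite_multigraph :: "('v, 'e) multigraph \<Rightarrow> bool" where
  "finite_multigraph G \<longleftrightarrow>
     finite (verts G) \<and> finite (edges G) \<and> (\<forall>e\<in>edges G. set_uprod (ends G e) \<subseteq> verts G)"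

text \<open>A subgraph has all the vertices of \<open>G\<close>, so it is given by its edge set \<open>S \<subseteq> edges G\<close>;
  a connected component is represented by its vertex set.\<close>

definition adjacency :: "('v, 'e) multigraph \<Rightarrow> 'e set \<Rightarrow> ('v \<times> 'v) set" where
  "adjacency G S = {(u, w). \<exists>e\<in>S. ends G e = Upair u w}"

definition component :: "('v, 'e) multigraph \<Rightarrow> 'e set \<Rightarrow> 'v \<Rightarrow> 'v set" where
  "component G S v = {w \<in> verts G. (v, w) \<in> (adjacency G S)\<^sup>*}"

definition components :: "('v, 'e) multigraph \<Rightarrow> 'e set \<Rightarrow> 'v set set" where
  "components G S = component G S ` verts G"

section \<open>The dichromatic polynomial\<close>

definition dichromatic :: "('v, 'e) multigraph \<Rightarrow> 'a \<Rightarrow> 'a \<Rightarrow> 'a::comm_ring_1" where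
  "dichromatic G v l = (\<Sum>S\<in>Pow (edges G). (-1) ^ card S * v ^ card S * l ^ card (components G S))"

text \<open>The polynomial ring in the indeterminates \<open>p\<close> and \<open>q\<close> over the integers is represented as
  the ring of polynomials in \<open>q\<close> with coefficients polynomials in \<open>p\<close>.\<close>

definition var_p :: "int poly poly" where "var_p = [:[:0, 1:]:]"

definition var_q :: "int poly poly" where "var_q = [:0, 1:]"

definition dichromatic_pq :: "('v, 'e) multigraph \<Rightarrow> int poly poly" where
  "dichromatic_pq G = dichromatic G (1 + var_p) (1 + var_q)"

section \<open>Refined enhanced states\<close>

datatype comp_label = C1 | Cx

datatype edge_label = E1 | Ey

text \<open>The product of labels in \<open>\<int>[x]/(x\<^sup>2)\<close>, where \<open>None\<close> stands for \<open>x \<cdot> x = 0\<close>.\<close>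

fun label_mult :: "comp_label \<Rightarrow> comp_label \<Rightarrow> comp_label option" where
  "label_mult C1 b = Some b"
| "label_mult Cx C1 = Some Cx"
| "label_mult Cx Cx = None"

datatype ('v, 'e) state = State
  (state_edges: "'e set")
  (clab: "'v set \<Rightarrow> comp_label option")
  (elab: "'e \<Rightarrow> edge_label option")

definition refined_states :: "('v, 'e) multigraph \<Rightarrow> ('v, 'e) state set" where
  "refined_states G =
     {s. state_edges s \<subseteq> edges G \<and>
         dom (clab s) = components G (state_edges s) \<and>
         dom (elab s) = state_edges s}"

definition num_y :: "('v, 'e) state \<Rightarrow> nat" where
  "num_y s = card {e. elab s e = Some Ey}"

definition num_x :: "('v, 'e) state \<Rightarrow> nat" where
  "num_x s = card {A. clab s A = Some Cx}"

definition graded_states :: "('v, 'e) multigraph \<Rightarrow> nat \<Rightarrow> nat \<Rightarrow> nat \<Rightarrow> ('v, 'e) state set" where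
  "graded_states G k i j =
     {s \<in> refined_states G. card (state_edges s) = k \<and> num_y s = i \<and> num_x s = j}"

section \<open>The dichromatic complex and its homology\<close>

definition chain_gp ::
    "('v, 'e) multigraph \<Rightarrow> nat \<Rightarrow> nat \<Rightarrow> nat \<Rightarrow> (('v, 'e) state \<Rightarrow>\<^sub>0 int) monoid" where
  "chain_gp G k i j = free_Abelian_group (graded_states G k i j)"

text \<open>The two ends of an edge named in an arbitrary order, on which the partial differential does
  not depend because \<open>label_mult\<close> is commutative.\<close>

definition end_pair :: "('v, 'e) multigraph \<Rightarrow> 'e \<Rightarrow> 'v \<times> 'v" where
  "end_pair G e = (SOME (u, w). ends G e = Upair u w)"

definition partial_diff ::
    "('v, 'e) multigraph \<Rightarrow> 'e \<Rightarrow> ('v, 'e) state \<Rightarrow> ('v, 'e) state \<Rightarrow>\<^sub>0 int" where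
  "partial_diff G e s =
     (let S = state_edges s;
          A = component G S (fst (end_pair G e));
          B = component G S (snd (end_pair G e));
          S' = insert e S;
          g' = (elab s)(e := Some E1)
      in if A = B then frag_of (State S' (clab s) g')
         else case label_mult (the (clab s A)) (the (clab s B)) of
                None \<Rightarrow> 0
              | Some m \<Rightarrow>
                  frag_of (State S' ((clab s)(A := None, B := None, A \<union> B := Some m)) g'))"

text \<open>The relation \<open>r\<close> is the chosen (reflexive) linear order on the edges.\<close>

definition num_preceding :: "'e rel \<Rightarrow> ('v, 'e) state \<Rightarrow> 'e \<Rightarrow> nat" where
  "num_preceding r s e = card {e' \<in> state_edges s. e' \<noteq> e \<and> (e', e) \<in> r}"

definition state_diff ::
    "('v, 'e) multigraph \<Rightarrow> 'e rel \<Rightarrow> ('v, 'e) state \<Rightarrow> ('v, 'e) state \<Rightarrow>\<^sub>0 int" where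
  "state_diff G r s =
     (\<Sum>e\<in>edges G - state_edges s. frag_cmul ((-1) ^ num_preceding r s e) (partial_diff G e s))"

definition differential ::
    "('v, 'e) multigraph \<Rightarrow> 'e rel \<Rightarrow>
     (('v, 'e) state \<Rightarrow>\<^sub>0 int) \<Rightarrow> (('v, 'e) state \<Rightarrow>\<^sub>0 int)" where
  "differential G r = frag_extend (state_diff G r)"

definition cycles ::
    "('v, 'e) multigraph \<Rightarrow> 'e rel \<Rightarrow> nat \<Rightarrow> nat \<Rightarrow> nat \<Rightarrow> (('v, 'e) state \<Rightarrow>\<^sub>0 int) set" where
  "cycles G r k i j = kernel (chain_gp G k i j) (chain_gp G (Suc k) i j) (differential G r)"

text \<open>There are no chains in degree \<open>-1\<close>, so the only boundary in degree \<open>0\<close> is \<open>0\<close>.\<close>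

definition boundaries ::
    "('v, 'e) multigraph \<Rightarrow> 'e rel \<Rightarrow> nat \<Rightarrow> nat \<Rightarrow> nat \<Rightarrow> (('v, 'e) state \<Rightarrow>\<^sub>0 int) set" where
  "boundaries G r k i j =
     (case k of 0 \<Rightarrow> {0} | Suc k' \<Rightarrow> differential G r ` carrier (chain_gp G k' i j))"

definition homology ::
    "('v, 'e) multigraph \<Rightarrow> 'e rel \<Rightarrow> nat \<Rightarrow> nat \<Rightarrow> nat \<Rightarrow>
     (('v, 'e) state \<Rightarrow>\<^sub>0 int) set monoid" where
  "homology G r k i j =
     subgroup_generated (chain_gp G k i j) (cycles G r k i j) Mod boundaries G r k i j"

section \<open>Rank and Euler characteristic\<close>

definition int_independent :: "('a, 'b) monoid_scheme \<Rightarrow> 'a set \<Rightarrow> bool" where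
  "int_independent A B \<longleftrightarrow>
     (\<forall>n :: 'a \<Rightarrow> int.
        finprod A (\<lambda>b. b [^]\<^bsub>A\<^esub> n b) B = \<one>\<^bsub>A\<^esub> \<longrightarrow> (\<forall>b\<in>B. n b = 0))"

text \<open>The rank of a finitely generated abelian group; for a group of infinite rank the
  supremum is taken over an unbounded set and has no meaning.\<close>

definition abelian_rank :: "('a, 'b) monoid_scheme \<Rightarrow> nat" where
  "abelian_rank A = Sup {card B | B. B \<subseteq> carrier A \<and> finite B \<and> int_independent A B}"

text \<open>\<open>Sum_any\<close> sums a family of finite support over all indices (and is \<open>0\<close> on infinite support).
  For a finite graph the homology vanishes unless \<open>k\<close> and \<open>i\<close> are at most the number of edges and
  \<open>j\<close> is at most the number of vertices.\<close>

definition homology_euler :: "('v, 'e) multigraph \<Rightarrow> 'e rel \<Rightarrow> nat \<Rightarrow> nat \<Rightarrow> int" where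
  "homology_euler G r i j = Sum_any (\<lambda>k. (-1) ^ k * int (abelian_rank (homology G r k i j)))"

end

theory Submission
  imports Defs
begin

text \<open>
  Expanding \<open>(1 + p)\<^bsup>e(S)\<^esup>\<close> as a sum over the sets of edges labelled \<open>y\<close>, and \<open>(1 + q)\<^bsup>c(S)\<^esup>\<close> as a sum over
  the sets of components labelled \<open>x\<close>, turns the dichromatic polynomial into the sum over all refined
  enhanced states \<open>s\<close> of \<open>(-1)\<^bsup>e(s)\<^esup> p\<^bsup>i(s)\<^esup> q\<^bsup>j(s)\<^esup>\<close> (\<open>dichromatic_eq_sum_states\<close>). The coefficient of
  \<open>p\<^bsup>i\<^esup> q\<^bsup>j\<^esup>\<close> is the alternating sum over \<open>k\<close> of the ranks of the chain groups \<open>C\<^bsup>k,i,j\<^esup>\<close>. For a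
  bounded complex of finitely generated free abelian groups this is the Euler characteristic of the
  homology (\<open>homology_euler_eq\<close>).

  The last step needs three things. The rank is additive: this is \<open>rank_kernel_image\<close> for the
  differential and \<open>abelian_rank_quotient\<close> for cycles modulo boundaries. Both are proved with maximal
  independent sets over the integers, whose cardinality is an invariant by the exchange argument in
  \<open>independent_card_le\<close>. The differential preserves \<open>i\<close> and \<open>j\<close> (\<open>differential_in_chains\<close>). Finally the
  boundaries must be cycles (\<open>differential_differential\<close>).

  For the last point a state is described by its edge set \<open>S\<close>, its set \<open>X\<close> of components labelled
  \<open>x\<close> and its set \<open>Y\<close> of edges labelled \<open>y\<close>. In these terms the partial differential for \<open>e\<close>
  replaces \<open>X\<close> by the set of components of \<open>S \<union> {e}\<close> that contain a member of \<open>X\<close>, and is \<open>0\<close> if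
  one of them contains two (\<open>partial_diff_encode\<close>). This makes sense for any larger edge set and is functorial in it
  (\<open>separated_push\<close>, \<open>push_push\<close>), so partial differentials commute, and the signs cancel the terms of
  the square of the differential in pairs.
\<close>

section \<open>Rank over an integral domain\<close>

text \<open>Modules over an integral domain; the case of interest is that of abelian groups, with the
  integers as scalars.\<close>

locale idom_module = module scale
  for scale :: "'r::idom \<Rightarrow> 'm::ab_group_add \<Rightarrow> 'm" (infixr "*s" 75)
begin

text \<open>A maximal independent subset of \<open>S\<close>: a finite independent subset in whose span every element
  of \<open>S\<close> has a nonzero multiple. Over a field this is a basis of the span of \<open>S\<close>; over an integral
  domain it replaces a basis, which need not exist.\<close>

definition max_indep :: "'m set \<Rightarrow> 'm set \<Rightarrow> bool" where
  "max_indep S B \<longleftrightarrow>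
     finite B \<and> B \<subseteq> S \<and> independent B \<and> (\<forall>z\<in>S. \<exists>m. m \<noteq> 0 \<and> m *s z \<in> span B)"

text \<open>The common cardinality of the maximal independent subsets of \<open>S\<close>; it is unspecified when there
  is none, which happens only for infinite rank.\<close>

definition rank :: "'m set \<Rightarrow> nat" where
  "rank S = card (SOME B. max_indep S B)"

end

text \<open>A homogeneous linear system with more unknowns than equations has a nontrivial solution, by
  fraction-free Gaussian elimination.\<close>

lemma homogeneous_system_nontrivial:
  fixes a :: "'e \<Rightarrow> 'x \<Rightarrow> 'r::idom"
  assumes "finite E" "finite X" "card E < card X"
  shows "\<exists>n. (\<exists>x\<in>X. n x \<noteq> 0) \<and> (\<forall>e\<in>E. (\<Sum>x\<in>X. n x * a e x) = 0)"
  using assms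
proof (induction E arbitrary: X a rule: finite_induct)
  case empty
  then have "X \<noteq> {}" by auto
  then show ?case by (intro exI[of _ "\<lambda>_. 1"]) auto
next
  case (insert e E)
  show ?case
  proof (cases "\<forall>x\<in>X. a e x = 0")
    case True
    then show ?thesis using insert.IH[of X a] insert.prems insert.hyps by auto
  next
    case False
    then obtain x0 where x0: "x0 \<in> X" "a e x0 \<noteq> 0" by blast
    \<comment> \<open>The pivot \<open>a e x0\<close> eliminates the unknown \<open>x0\<close> from the other equations.\<close>
    define X' where "X' = X - {x0}"
    have X: "X = insert x0 X'" "x0 \<notin> X'" "finite X'" using x0 insert.prems by (auto simp: X'_def)
    have "card E < card X'" using insert X by simp
    from insert.IH[OF X(3) this, of "\<lambda>f x. a e x0 * a f x - a f x0 * a e x"]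
    obtain n where n: "\<exists>x\<in>X'. n x \<noteq> 0"
      "\<And>f. f \<in> E \<Longrightarrow> (\<Sum>x\<in>X'. n x * (a e x0 * a f x - a f x0 * a e x)) = 0" by blast
    define m where "m x = (if x = x0 then - (\<Sum>x\<in>X'. n x * a e x) else a e x0 * n x)" for x
    have sum_m: "(\<Sum>x\<in>X. m x * a f x)
        = a e x0 * (\<Sum>x\<in>X'. n x * a f x) - a f x0 * (\<Sum>x\<in>X'. n x * a e x)" for f
    proof -
      have "(\<Sum>x\<in>X'. m x * a f x) = (\<Sum>x\<in>X'. a e x0 * (n x * a f x))"
        using X(2) by (intro sum.cong) (auto simp: m_def algebra_simps)
      then show ?thesis
        using X by (simp add: m_def sum_distrib_left algebra_simps)
    qed
    have "(\<Sum>x\<in>X. m x * a f x) = 0" if "f \<in> insert e E" for f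
    proof (cases "f = e")
      case False
      then show ?thesis
        using n(2)[of f] that unfolding sum_m
        by (simp add: sum_distrib_left sum_subtractf algebra_simps)
    qed (simp add: sum_m)
    moreover have "\<exists>x\<in>X. m x \<noteq> 0"
      using n(1) x0 X by (auto simp: m_def)
    ultimately show ?thesis by blast
  qed
qed

context idom_module
begin

lemma span_finite_coeffs:
  assumes "finite B" "x \<in> span B"
  obtains c where "x = (\<Sum>b\<in>B. c b *s b)"
  using assms by (auto simp: span_finite)

text \<open>Steinitz exchange: a linear relation among the elements of \<open>A\<close> is a solution of a system with
  one equation for every element of \<open>B\<close> and one unknown for every element of \<open>A\<close>.\<close>

lemma independent_card_le:
  assumes "finite A" "independent A" "finite B" "\<And>a. a \<in> A \<Longrightarrow> \<exists>m. m \<noteq> 0 \<and> m *s a \<in> span B"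
  shows "card A \<le> card B"
proof (rule ccontr)
  assume "\<not> ?thesis"
  then have less: "card B < card A" by simp
  have "\<exists>m c. m \<noteq> 0 \<and> m *s a = (\<Sum>b\<in>B. c b *s b)" if a: "a \<in> A" for a
    using assms(4)[OF a] span_finite_coeffs[OF assms(3)] by metis
  then obtain m c where mc: "\<And>a. a \<in> A \<Longrightarrow> m a \<noteq> 0"
      "\<And>a. a \<in> A \<Longrightarrow> m a *s a = (\<Sum>b\<in>B. c a b *s b)" by metis
  obtain n where n: "\<exists>a\<in>A. n a \<noteq> 0" "\<And>b. b \<in> B \<Longrightarrow> (\<Sum>a\<in>A. n a * c a b) = 0"
    using homogeneous_system_nontrivial[OF assms(3,1) less, of "\<lambda>b a. c a b"] by blast
  have "(\<Sum>a\<in>A. (n a * m a) *s a) = (\<Sum>a\<in>A. \<Sum>b\<in>B. (n a * c a b) *s b)"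
  proof (rule sum.cong[OF refl])
    fix a assume "a \<in> A"
    have "(n a * m a) *s a = n a *s (m a *s a)" by simp
    also have "\<dots> = n a *s (\<Sum>b\<in>B. c a b *s b)" using mc(2)[OF \<open>a \<in> A\<close>] by simp
    also have "\<dots> = (\<Sum>b\<in>B. (n a * c a b) *s b)" by (simp add: scale_sum_right)
    finally show "(n a * m a) *s a = (\<Sum>b\<in>B. (n a * c a b) *s b)" .
  qed
  also have "\<dots> = (\<Sum>b\<in>B. (\<Sum>a\<in>A. n a * c a b) *s b)"
    by (subst sum.swap) (simp add: scale_sum_left)
  also have "\<dots> = 0" using n(2) by simp
  finally have "n a * m a = 0" if "a \<in> A" for a
    using independentD[OF assms(2,1) subset_refl, of "\<lambda>a. n a * m a" a] that by simp
  then show False using n(1) mc(1) by auto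
qed

lemma independent_insert_torsion_free:
  assumes "finite B" "independent B" "\<And>m. m \<noteq> 0 \<Longrightarrow> m *s z \<notin> span B"
  shows "independent (insert z B)" "z \<notin> B"
proof -
  show z: "z \<notin> B" using assms(3)[of 1] span_base by auto
  have "\<forall>v\<in>insert z B. u v = 0" if u: "(\<Sum>v\<in>insert z B. u v *s v) = 0" for u
  proof -
    have e: "u z *s z + (\<Sum>v\<in>B. u v *s v) = 0" using u z assms(1) by simp
    then have "u z *s z = - (\<Sum>v\<in>B. u v *s v)" by (simp add: eq_neg_iff_add_eq_0)
    then have "u z *s z \<in> span B" by (simp add: span_neg span_sum span_scale span_base)
    then have 0: "u z = 0" using assms(3) by blast
    then show ?thesis using e independentD[OF assms(2,1) subset_refl, of u] by auto
  qed
  then show "independent (insert z B)" using assms(1) by (auto simp: dependent_finite)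
qed

lemma max_indep_extend:
  assumes "finite A" "A \<subseteq> S" "independent A" "finite F" "S \<subseteq> span F"
  obtains B where "max_indep S B" "A \<subseteq> B"
proof -
  define P where "P B \<longleftrightarrow> finite B \<and> A \<subseteq> B \<and> B \<subseteq> S \<and> independent B" for B
  have bound: "card B \<le> card F" if "P B" for B
    using that assms(4,5) unfolding P_def
    by (intro independent_card_le) (auto intro!: exI[of _ 1])
  have "P A" using assms by (simp add: P_def)
  then obtain B where B: "P B" "\<And>B'. P B' \<Longrightarrow> card B' \<le> card B"
    using ex_has_greatest_nat[of P A card "Suc (card F)"] bound by (meson le_imp_less_Suc)
  have "\<exists>m. m \<noteq> 0 \<and> m *s z \<in> span B" if z: "z \<in> S" for z
  proof (rule ccontr)
    assume "\<not> ?thesis"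
    with B(1) have "independent (insert z B)" "z \<notin> B"
      using independent_insert_torsion_free[of B z] by (auto simp: P_def)
    then show False using B z B(2)[of "insert z B"] by (auto simp: P_def)
  qed
  then show ?thesis using that[of B] B(1) by (auto simp: P_def max_indep_def)
qed

lemma max_indep_card_unique:
  assumes "max_indep S B" "max_indep S C"
  shows "card B = card C"
proof -
  have "card B \<le> card C" if "max_indep S B" "max_indep S C" for B C
    by (rule independent_card_le) (use that in \<open>unfold max_indep_def, blast+\<close>)
  then show ?thesis using assms by (metis antisym)
qed

lemma rank_eq_card: "max_indep S B \<Longrightarrow> rank S = card B"
  unfolding rank_def by (metis max_indep_card_unique someI_ex)

lemma independent_card_le_rank:
  assumes "finite A" "A \<subseteq> S" "independent A" "finite F" "S \<subseteq> span F"
  shows "card A \<le> rank S"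
proof -
  obtain B where B: "max_indep S B" "A \<subseteq> B" using max_indep_extend[OF assms] .
  then show ?thesis using rank_eq_card[OF B(1)] by (auto simp: max_indep_def intro: card_mono)
qed

lemma rank_mono:
  assumes "S \<subseteq> T" "finite F" "T \<subseteq> span F"
  shows "rank S \<le> rank T"
proof -
  obtain B where B: "max_indep S B"
  proof (rule max_indep_extend[of "{}" S F])
    show "S \<subseteq> span F" using assms by blast
  qed (use assms independent_empty in auto)
  then have "card B \<le> rank T"
    using assms by (intro independent_card_le_rank[of B T F]) (auto simp: max_indep_def)
  then show ?thesis using rank_eq_card[OF B] by simp
qed

lemma rank_span:
  assumes "finite B" "independent B"
  shows "rank (span B) = card B"
proof (rule rank_eq_card)
  have "\<exists>m. m \<noteq> 0 \<and> m *s z \<in> span B" if "z \<in> span B" for z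
    using that by (intro exI[of _ 1]) simp
  then show "max_indep (span B) B"
    using assms span_superset unfolding max_indep_def by blast
qed

text \<open>Extending a maximal independent subset \<open>K\<close> of \<open>N\<close> to an independent set \<open>B\<close> yields elements
  \<open>B - K\<close> that are independent modulo \<open>N\<close>; the next lemma is a converse.\<close>

lemma max_indep_independent_mod:
  assumes K: "max_indep N K" and B: "finite B" "independent B" "K \<subseteq> B"
    and u: "(\<Sum>c\<in>B - K. u c *s c) \<in> N"
  shows "\<forall>c\<in>B - K. u c = 0"
proof -
  let ?x = "\<Sum>c\<in>B - K. u c *s c"
  have K': "finite K" using B finite_subset by blast
  obtain m where m: "m \<noteq> 0" "m *s ?x \<in> span K"
    using K u by (auto simp: max_indep_def)
  obtain k where k: "m *s ?x = (\<Sum>b\<in>K. k b *s b)" using span_finite_coeffs[OF K' m(2)] .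
  define w where "w b = (if b \<in> K then - k b else m * u b)" for b
  have "(\<Sum>b\<in>B. w b *s b) = (\<Sum>b\<in>B - K. w b *s b) + (\<Sum>b\<in>K. w b *s b)"
    by (rule sum.subset_diff[OF B(3,1)])
  also have "(\<Sum>b\<in>B - K. w b *s b) = m *s ?x"
    unfolding scale_sum_right by (intro sum.cong) (auto simp: w_def)
  also have "(\<Sum>b\<in>K. w b *s b) = - (\<Sum>b\<in>K. k b *s b)"
    unfolding sum_negf[symmetric] by (intro sum.cong) (auto simp: w_def)
  finally have "(\<Sum>b\<in>B. w b *s b) = 0" using k by simp
  then have "w c = 0" if "c \<in> B" for c
    using independentD[OF B(2,1) subset_refl, of w c] that by auto
  then show ?thesis using m(1) by (force simp: w_def)
qed

lemma independent_mod_Un: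
  assumes R: "finite R" "\<And>u. (\<Sum>r\<in>R. u r *s r) \<in> N \<Longrightarrow> \<forall>r\<in>R. u r = 0"
    and K: "finite K" "independent K" "K \<subseteq> N" and N: "subspace N"
  shows "independent (R \<union> K)" "R \<inter> K = {}"
proof -
  show disj: "R \<inter> K = {}"
  proof (rule ccontr)
    assume "R \<inter> K \<noteq> {}"
    then obtain r where r: "r \<in> R" "r \<in> K" by blast
    define u :: "'m \<Rightarrow> 'r" where "u x = (if x = r then 1 else 0)" for x
    have "(\<Sum>x\<in>R. u x *s x) = (\<Sum>x\<in>{r}. u x *s x)"
      using r R by (intro sum.mono_neutral_right) (auto simp: u_def)
    then have "(\<Sum>x\<in>R. u x *s x) \<in> N" using r K by (auto simp: u_def)
    then have "u r = 0" using R(2) r by blast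
    then show False by (simp add: u_def)
  qed
  have "\<forall>v\<in>R \<union> K. u v = 0" if u: "(\<Sum>v\<in>R \<union> K. u v *s v) = 0" for u
  proof -
    have e: "(\<Sum>v\<in>R. u v *s v) + (\<Sum>v\<in>K. u v *s v) = 0"
      using u R K disj by (simp add: sum.union_disjoint)
    then have "(\<Sum>v\<in>R. u v *s v) = - (\<Sum>v\<in>K. u v *s v)" by (simp add: eq_neg_iff_add_eq_0)
    also have "\<dots> \<in> N" using K N by (auto intro!: subspace_neg subspace_sum subspace_scale)
    finally have 0: "\<forall>r\<in>R. u r = 0" by (rule R(2))
    then have "(\<Sum>v\<in>K. u v *s v) = 0" using e by simp
    then show ?thesis using 0 independentD[OF K(2,1) subset_refl, of u] by auto
  qed
  then show "independent (R \<union> K)" using R K by (auto simp: dependent_finite)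
qed

text \<open>The rank--nullity theorem.\<close>

lemma rank_kernel_image:
  assumes f: "module_hom scale scale f" and S: "subspace S"
    and F: "finite F" "S \<subseteq> span F"
  shows "rank S = rank {x \<in> S. f x = 0} + rank (f ` S)"
proof -
  interpret f: module_hom scale scale f by fact
  let ?K = "{x \<in> S. f x = 0}"
  obtain K where K: "max_indep ?K K"
  proof (rule max_indep_extend[of "{}" ?K F])
    show "?K \<subseteq> span F" using F by auto
  qed (use F independent_empty in auto)
  then have Kd: "finite K" "K \<subseteq> S" "independent K" by (auto simp: max_indep_def)
  obtain B where B: "max_indep S B" "K \<subseteq> B" using max_indep_extend[OF Kd F] .
  define C where "C = B - K"
  have Bd: "finite B" "B \<subseteq> S" "independent B" "finite C" "C \<subseteq> S" "B = C \<union> K" "C \<inter> K = {}"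
    using B by (auto simp: max_indep_def C_def)
  have lift: "\<forall>c\<in>C. u c = 0" if u: "(\<Sum>c\<in>C. u c *s f c) = 0" for u
  proof -
    have "(\<Sum>c\<in>C. u c *s c) \<in> ?K"
      using u Bd S by (auto simp: f.sum f.scale intro!: subspace_sum subspace_scale)
    then show ?thesis
      using max_indep_independent_mod[OF K Bd(1,3) B(2)] by (simp add: C_def)
  qed
  have inj: "inj_on f C"
  proof (rule inj_onI, rule ccontr)
    fix c c' assume c: "c \<in> C" "c' \<in> C" "f c = f c'" "c \<noteq> c'"
    define u :: "'m \<Rightarrow> 'r" where "u x = (if x = c then 1 else if x = c' then - 1 else 0)" for x
    have "(\<Sum>x\<in>C. u x *s f x) = (\<Sum>x\<in>{c,c'}. u x *s f x)"
      using c Bd by (intro sum.mono_neutral_right) (auto simp: u_def)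
    also have "\<dots> = 0" using c by (simp add: u_def)
    finally have "u c = 0" using lift c by blast
    then show False by (simp add: u_def)
  qed
  have "max_indep (f ` S) (f ` C)"
    unfolding max_indep_def
  proof (intro conjI ballI)
    show "finite (f ` C)" "f ` C \<subseteq> f ` S" using Bd by auto
    show "independent (f ` C)"
    proof -
      have "\<forall>c\<in>C. u (f c) = 0" if "(\<Sum>v\<in>f ` C. u v *s v) = 0" for u
        using lift[of "\<lambda>c. u (f c)"] that inj by (simp add: sum.reindex)
      then show ?thesis using Bd(4) by (auto simp: dependent_finite)
    qed
    fix z assume "z \<in> f ` S"
    then obtain x where x: "x \<in> S" "z = f x" by blast
    then obtain m where m: "m \<noteq> 0" "m *s x \<in> span B" using B by (auto simp: max_indep_def)
    have "f (m *s x) \<in> span (f ` B)" using m by (simp add: f.span_image)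
    also have "f ` B \<subseteq> span (f ` C)"
      using Bd(6) K by (auto simp: max_indep_def span_base span_zero)
    then have "span (f ` B) \<subseteq> span (f ` C)" by (rule span_minimal) simp
    finally show "\<exists>m. m \<noteq> 0 \<and> m *s z \<in> span (f ` C)" using m x by (auto simp: f.scale)
  qed
  then have "rank (f ` S) = card C" using inj by (simp add: rank_eq_card card_image)
  moreover have "rank S = card C + card K"
    using rank_eq_card[OF B(1)] Bd Kd by (simp add: card_Un_disjoint)
  ultimately show ?thesis using rank_eq_card[OF K] by simp
qed

end

section \<open>Rank of quotients of subgroups of free abelian groups\<close>

interpretation frag: idom_module frag_cmul
  by unfold_locales (simp_all add: frag_cmul_distrib frag_cmul_distrib2)

lemma subspace_carrier_free_Abelian_group: "frag.subspace (carrier (free_Abelian_group S))"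
  by (intro frag.subspaceI) (auto dest: subsetD[OF keys_add])

lemma span_frag_of: "frag.span (frag_of ` S) = carrier (free_Abelian_group S)"
proof (rule frag.span_unique)
  show "frag_of ` S \<subseteq> carrier (free_Abelian_group S)" by auto
  show "frag.subspace (carrier (free_Abelian_group S))"
    by (rule subspace_carrier_free_Abelian_group)
  fix T assume T: "frag_of ` S \<subseteq> T" "frag.subspace T"
  show "carrier (free_Abelian_group S) \<subseteq> T"
  proof
    fix x assume "x \<in> carrier (free_Abelian_group S)"
    then have "Poly_Mapping.keys x \<subseteq> S" by simp
    then show "x \<in> T"
      by (rule free_Abelian_group_induct)
        (use T in \<open>auto intro: frag.subspace_0 frag.subspace_diff\<close>)
  qed
qed

lemma rank_free_Abelian_group:
  assumes "finite S"
  shows "frag.rank (carrier (free_Abelian_group S)) = card S"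
proof -
  have inj: "inj_on frag_of S" by (simp add: frag_of_eq inj_on_def)
  have "u (frag_of s) = 0" if "(\<Sum>v\<in>frag_of ` S. frag_cmul (u v) v) = 0" "s \<in> S" for u s
  proof -
    have "0 = poly_mapping.lookup (\<Sum>t\<in>S. frag_cmul (u (frag_of t)) (frag_of t)) s"
      using that inj by (simp add: sum.reindex)
    also have "\<dots> = (\<Sum>t\<in>S. if t = s then u (frag_of t) else 0)"
      unfolding lookup_sum by (intro sum.cong) (auto simp: lookup_single when_def)
    also have "\<dots> = u (frag_of s)" using assms that by simp
    finally show ?thesis by simp
  qed
  then have "frag.independent (frag_of ` S)"
    using assms by (auto simp: frag.dependent_finite)
  then show ?thesis
    using assms inj frag.rank_span[of "frag_of ` S"] by (simp add: span_frag_of card_image)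
qed

text \<open>A maximal independent subset of \<open>N\<close> is extended to one of \<open>Z\<close>; the cosets of the added elements
  are independent in \<open>Z / N\<close>. They are of maximal number, because representatives of any independent
  set of cosets, together with the chosen subset of \<open>N\<close>, are independent in \<open>Z\<close>.\<close>

lemma abelian_rank_quotient:
  fixes Z N :: "('a \<Rightarrow>\<^sub>0 int) set"
  assumes S: "finite S" and Z: "frag.subspace Z" "Z \<subseteq> carrier (free_Abelian_group S)"
    and N: "frag.subspace N" "N \<subseteq> Z"
  shows "abelian_rank (subgroup_generated (free_Abelian_group S) Z Mod N)
         = frag.rank Z - frag.rank N"
proof -
  let ?F = "free_Abelian_group S"
  let ?H = "subgroup_generated ?F Z"
  let ?Q = "?H Mod N"
  have sub: "subgroup U ?F" if "frag.subspace U" "U \<subseteq> Z" for U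
  proof
    show "inv\<^bsub>?F\<^esub> x \<in> U" if "x \<in> U" for x
      using that \<open>U \<subseteq> Z\<close> \<open>frag.subspace U\<close> Z by (auto simp: frag.subspace_neg subset_iff)
  qed (use that Z in \<open>auto simp: frag.subspace_0 frag.subspace_add subset_iff\<close>)
  have carH: "carrier ?H = Z"
    using sub[OF Z(1) subset_refl] by (rule subgroup.carrier_subgroup_generated_subgroup)
  have comH: "comm_group ?H"
    by (intro group.abelian_subgroup_generated abelian_free_Abelian_group) simp
  have subN: "subgroup N ?H"
    using sub[OF N] sub[OF Z(1) subset_refl] N
    by (simp add: group.subgroup_subgroup_generated_iff carH)
  interpret H: comm_group ?H by (rule comH)
  interpret Q: comm_group ?Q by (rule H.abelian_FactGroup[OF subN])
  interpret normal N ?H by (rule H.subgroup_imp_normal[OF subN])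
  define \<pi> where "\<pi> x = N #>\<^bsub>?H\<^esub> x" for x
  have \<pi>_eq: "\<pi> x = {n + x | n. n \<in> N}" for x
    by (auto simp: \<pi>_def r_coset_def)
  have \<pi>_hom: "\<pi> \<in> hom ?H ?Q" unfolding \<pi>_def by (rule r_coset_hom_Mod)
  have \<pi>_self: "x \<in> \<pi> x" for x
    unfolding \<pi>_eq using frag.subspace_0[OF N(1)] by (intro CollectI exI[of _ 0]) simp
  have \<pi>_diff: "x - y \<in> N" if "\<pi> x = \<pi> y" for x y
  proof -
    have "x \<in> \<pi> y" using \<pi>_self[of x] that by simp
    then show ?thesis unfolding \<pi>_eq by clarsimp
  qed
  have oneQ: "\<one>\<^bsub>?Q\<^esub> = N" by (simp add: FactGroup_def)
  have \<pi>_one: "\<pi> x = \<one>\<^bsub>?Q\<^esub> \<longleftrightarrow> x \<in> N" for x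
  proof
    assume "\<pi> x = \<one>\<^bsub>?Q\<^esub>"
    then show "x \<in> N" using \<pi>_self[of x] oneQ by simp
  next
    assume x: "x \<in> N"
    have "\<pi> x \<subseteq> N" unfolding \<pi>_eq using frag.subspace_add[OF N(1) _ x] by blast
    moreover have "y \<in> \<pi> x" if "y \<in> N" for y
      unfolding \<pi>_eq using frag.subspace_diff[OF N(1) that x]
      by (intro CollectI exI[of _ "y - x"]) simp
    ultimately show "\<pi> x = \<one>\<^bsub>?Q\<^esub>" unfolding oneQ by blast
  qed
  have \<pi>_carr: "carrier ?Q = \<pi> ` Z"
    by (auto simp: carrier_FactGroup carH \<pi>_def)
  have \<pi>_closed: "\<pi> x \<in> carrier ?Q" if "x \<in> Z" for x
    using that by (simp add: \<pi>_carr)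
  have \<pi>_sum: "finprod ?Q (\<lambda>b. \<pi> (\<rho> b) [^]\<^bsub>?Q\<^esub> (n b)) B = \<pi> (\<Sum>b\<in>B. frag_cmul (n b) (\<rho> b))"
    if "finite B" "\<rho> ` B \<subseteq> Z" for n :: "'b \<Rightarrow> int" and \<rho> :: "'b \<Rightarrow> 'a \<Rightarrow>\<^sub>0 int" and B
    using that
  proof (induction B rule: finite_induct)
    case empty
    have "\<pi> 0 = \<one>\<^bsub>?Q\<^esub>" using \<pi>_one frag.subspace_0[OF N(1)] by blast
    then show ?case by simp
  next
    case (insert b B)
    have pow: "\<pi> x [^]\<^bsub>?Q\<^esub> k = \<pi> (frag_cmul k x)" if "x \<in> Z" for x and k :: int
    proof -
      have "x [^]\<^bsub>?H\<^esub> k = frag_cmul k x"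
        using that Z(2) carH
        by (metis carrier_free_Abelian_group_iff group.int_pow_subgroup_generated
            group_free_Abelian_group int_pow_free_Abelian_group subsetD)
      then show ?thesis
        using hom_int_pow[OF \<pi>_hom _ H.group_axioms Q.group_axioms, of x k] that carH by simp
    qed
    have cl: "(\<lambda>b. \<pi> (\<rho> b) [^]\<^bsub>?Q\<^esub> n b) \<in> B \<rightarrow> carrier ?Q"
      using insert.prems by (auto intro!: Q.int_pow_closed \<pi>_closed)
    have "(\<Sum>b\<in>B. frag_cmul (n b) (\<rho> b)) \<in> Z" "frag_cmul (n b) (\<rho> b) \<in> Z"
      using insert.prems Z(1) by (auto intro!: frag.subspace_sum frag.subspace_scale)
    then have "\<pi> (frag_cmul (n b) (\<rho> b)) \<otimes>\<^bsub>?Q\<^esub> \<pi> (\<Sum>b\<in>B. frag_cmul (n b) (\<rho> b))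
      = \<pi> (\<Sum>b\<in>insert b B. frag_cmul (n b) (\<rho> b))"
      using hom_mult[OF \<pi>_hom] insert.hyps carH by simp
    moreover have "\<pi> (\<rho> b) [^]\<^bsub>?Q\<^esub> n b \<in> carrier ?Q"
      using insert.prems by (auto intro!: Q.int_pow_closed \<pi>_closed)
    moreover have "\<pi> (\<rho> b) [^]\<^bsub>?Q\<^esub> n b = \<pi> (frag_cmul (n b) (\<rho> b))"
      using insert.prems by (intro pow) auto
    moreover have "finprod ?Q (\<lambda>b. \<pi> (\<rho> b) [^]\<^bsub>?Q\<^esub> n b) B = \<pi> (\<Sum>b\<in>B. frag_cmul (n b) (\<rho> b))"
      using insert.prems by (intro insert.IH) auto
    ultimately show ?case
      by (simp only: Q.finprod_insert[OF insert.hyps cl])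
  qed
  have fin: "finite (frag_of ` S)" "Z \<subseteq> frag.span (frag_of ` S)"
    using S Z by (auto simp: span_frag_of)
  obtain K where K: "frag.max_indep N K"
  proof (rule frag.max_indep_extend[of "{}" N "frag_of ` S"])
    show "N \<subseteq> frag.span (frag_of ` S)" using N fin by auto
  qed (use fin frag.independent_empty in auto)
  then have Kd: "finite K" "K \<subseteq> N" "frag.independent K" by (auto simp: frag.max_indep_def)
  obtain B where B: "frag.max_indep Z B" "K \<subseteq> B"
    using frag.max_indep_extend[OF Kd(1) _ Kd(3) fin] Kd(2) N(2) by blast
  then have Bd: "finite B" "B \<subseteq> Z" "frag.independent B" by (auto simp: frag.max_indep_def)
  let ?r = "frag.rank Z - frag.rank N"
  define R where "R = B - K"
  have R: "finite R" "R \<subseteq> Z" "card R = ?r"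
    using B Bd Kd K by (auto simp: R_def frag.rank_eq_card card_Diff_subset)
  have R_mod: "\<forall>r\<in>R. u r = 0" if "(\<Sum>r\<in>R. frag_cmul (u r) r) \<in> N" for u
    using frag.max_indep_independent_mod[OF K Bd(1,3) B(2)] that by (simp add: R_def)
  have inj: "inj_on \<pi> R"
  proof (rule inj_onI, rule ccontr)
    fix c c' assume c: "c \<in> R" "c' \<in> R" "\<pi> c = \<pi> c'" "c \<noteq> c'"
    define u :: "('a \<Rightarrow>\<^sub>0 int) \<Rightarrow> int"
      where "u x = (if x = c then 1 else if x = c' then - 1 else 0)" for x
    have "(\<Sum>x\<in>R. frag_cmul (u x) x) = (\<Sum>x\<in>{c,c'}. frag_cmul (u x) x)"
      using c R by (intro sum.mono_neutral_right) (auto simp: u_def)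
    also have "\<dots> = c - c'" using c by (simp add: u_def)
    finally have "u c = 0" using R_mod[of u] \<pi>_diff[OF c(3)] c by auto
    then show False by (simp add: u_def)
  qed
  have "int_independent ?Q (\<pi> ` R)"
    unfolding int_independent_def
  proof (intro allI impI ballI)
    fix n :: "('a \<Rightarrow>\<^sub>0 int) set \<Rightarrow> int" and b
    assume n: "finprod ?Q (\<lambda>b. b [^]\<^bsub>?Q\<^esub> n b) (\<pi> ` R) = \<one>\<^bsub>?Q\<^esub>" and b: "b \<in> \<pi> ` R"
    have "finprod ?Q (\<lambda>b. b [^]\<^bsub>?Q\<^esub> n b) (\<pi> ` R) = finprod ?Q (\<lambda>r. \<pi> r [^]\<^bsub>?Q\<^esub> n (\<pi> r)) R"
      using R inj by (intro Q.finprod_reindex) (auto intro!: Q.int_pow_closed \<pi>_closed)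
    also have "\<dots> = \<pi> (\<Sum>r\<in>R. frag_cmul (n (\<pi> r)) r)"
      using \<pi>_sum[of R "\<lambda>x. x" "\<lambda>r. n (\<pi> r)"] R by auto
    finally have "\<pi> (\<Sum>r\<in>R. frag_cmul (n (\<pi> r)) r) = \<one>\<^bsub>?Q\<^esub>" unfolding n by (rule sym)
    then have "(\<Sum>r\<in>R. frag_cmul (n (\<pi> r)) r) \<in> N" by (simp only: \<pi>_one)
    then have "\<forall>r\<in>R. n (\<pi> r) = 0" by (rule R_mod)
    then show "n b = 0" using b by auto
  qed
  moreover have "\<pi> ` R \<subseteq> carrier ?Q" using R by (auto simp: \<pi>_carr)
  ultimately have attained: "?r \<in> {card B | B. B \<subseteq> carrier ?Q \<and> finite B \<and> int_independent ?Q B}"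
    using R inj card_image[OF inj] by (intro CollectI exI[of _ "\<pi> ` R"]) auto
  have bound: "card D \<le> ?r" if D: "D \<subseteq> carrier ?Q" "finite D" "int_independent ?Q D" for D
  proof -
    define \<rho> where "\<rho> b = (SOME x. x \<in> Z \<and> \<pi> x = b)" for b
    have \<rho>: "\<rho> b \<in> Z" "\<pi> (\<rho> b) = b" if "b \<in> D" for b
      unfolding \<rho>_def using someI_ex[of "\<lambda>x. x \<in> Z \<and> \<pi> x = b"] D(1) that
      by (auto simp: \<pi>_carr)
    have inj\<rho>: "inj_on \<rho> D" using \<rho>(2) by (metis inj_onI)
    have D_mod: "\<forall>r\<in>\<rho> ` D. u r = 0" if u: "(\<Sum>r\<in>\<rho> ` D. frag_cmul (u r) r) \<in> N" for u
    proof -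
      have "finprod ?Q (\<lambda>b. b [^]\<^bsub>?Q\<^esub> u (\<rho> b)) D
          = finprod ?Q (\<lambda>b. \<pi> (\<rho> b) [^]\<^bsub>?Q\<^esub> u (\<rho> b)) D"
        using D \<rho> by (intro Q.finprod_cong') (auto intro!: Q.int_pow_closed \<pi>_closed)
      also have "\<dots> = \<pi> (\<Sum>b\<in>D. frag_cmul (u (\<rho> b)) (\<rho> b))"
        using \<rho> D by (intro \<pi>_sum) auto
      also have "\<dots> = \<one>\<^bsub>?Q\<^esub>"
        unfolding \<pi>_one using u inj\<rho> by (simp add: sum.reindex)
      finally have "\<forall>b\<in>D. u (\<rho> b) = 0"
        using D(3) by (auto simp: int_independent_def)
      then show ?thesis by simp
    qed
    have "finite (\<rho> ` D)" using D by simp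
    from frag.independent_mod_Un[OF this D_mod Kd(1,3,2) N(1)]
    have ind: "frag.independent (\<rho> ` D \<union> K)" "\<rho> ` D \<inter> K = {}" by auto
    then have "card (\<rho> ` D \<union> K) \<le> frag.rank Z"
      using D Kd \<rho> N(2) by (intro frag.independent_card_le_rank[OF _ _ _ fin]) auto
    moreover have "card (\<rho> ` D \<union> K) = card D + frag.rank N"
      using ind Kd D card_image[OF inj\<rho>] frag.rank_eq_card[OF K] by (simp add: card_Un_disjoint)
    ultimately show ?thesis by simp
  qed
  show ?thesis
    unfolding abelian_rank_def using attained bound by (intro cSup_eq_maximum) auto
qed

section \<open>Connected components of subgraphs\<close>

locale fin_graph =
  fixes G :: "('v, 'e) multigraph"
  assumes finite_multigraph: "finite_multigraph G"
begin

lemma finite_verts: "finite (verts G)" and finite_edges: "finite (edges G)"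
  using finite_multigraph by (auto simp: finite_multigraph_def)

lemma finite_subgraph: "S \<subseteq> edges G \<Longrightarrow> finite S"
  using finite_edges finite_subset by blast

lemma end_pair_verts:
  assumes "e \<in> edges G"
  obtains u w where "end_pair G e = (u, w)" "ends G e = Upair u w" "u \<in> verts G" "w \<in> verts G"
proof -
  obtain a b where ab: "ends G e = Upair a b" by (cases "ends G e") auto
  obtain u w where uw: "end_pair G e = (u, w)" by fastforce
  have "case end_pair G e of (u, w) \<Rightarrow> ends G e = Upair u w"
    unfolding end_pair_def by (rule someI[of _ "(a, b)"]) (simp add: ab)
  then have "ends G e = Upair u w" by (simp add: uw)
  moreover from this have "u \<in> verts G" "w \<in> verts G"
    using assms finite_multigraph by (auto simp: finite_multigraph_def)
  ultimately show ?thesis using that uw by blast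
qed

lemma adjacency_sym: "(u, w) \<in> (adjacency G S)\<^sup>* \<Longrightarrow> (w, u) \<in> (adjacency G S)\<^sup>*"
proof -
  have "sym (adjacency G S)"
    by (auto simp: sym_def adjacency_def intro!: bexI)
  then show "(u, w) \<in> (adjacency G S)\<^sup>* \<Longrightarrow> (w, u) \<in> (adjacency G S)\<^sup>*"
    by (metis sym_rtrancl symD)
qed

lemma adjacency_mono: "S \<subseteq> T \<Longrightarrow> adjacency G S \<subseteq> adjacency G T"
  by (auto simp: adjacency_def)

lemma component_self: "v \<in> verts G \<Longrightarrow> v \<in> component G S v"
  by (simp add: component_def)

lemma component_mono: "S \<subseteq> T \<Longrightarrow> component G S v \<subseteq> component G T v"
  using rtrancl_mono[OF adjacency_mono] by (auto simp: component_def)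

lemma component_eq: "w \<in> component G S v \<Longrightarrow> component G S w = component G S v"
  unfolding component_def
  by (auto intro: rtrancl_trans dest: adjacency_sym)

lemma components_nonempty: "C \<in> components G S \<Longrightarrow> C \<noteq> {}"
  using component_self by (auto simp: components_def)

lemma component_in_components: "v \<in> verts G \<Longrightarrow> component G S v \<in> components G S"
  by (simp add: components_def)

lemma components_component: "C \<in> components G S \<Longrightarrow> v \<in> C \<Longrightarrow> C = component G S v"
  using component_eq by (auto simp: components_def)

lemma components_subset_eq:
  "C \<in> components G S \<Longrightarrow> D \<in> components G S \<Longrightarrow> D \<subseteq> C \<Longrightarrow> D = C"
  by (metis components_component components_nonempty equals0I subsetD)

lemma finite_components: "finite (components G S)"
  by (simp add: components_def finite_verts)

lemma components_eq_if_meet: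
  "C \<in> components G S \<Longrightarrow> D \<in> components G S \<Longrightarrow> E \<noteq> {} \<Longrightarrow> E \<subseteq> C \<Longrightarrow> E \<subseteq> D \<Longrightarrow> C = D"
  by (metis components_component equals0I subsetD)

lemma intermediate_component:
  assumes S: "S \<subseteq> T" "T \<subseteq> U" and D: "D \<in> components G S" "D \<subseteq> C" and C: "C \<in> components G U"
  shows "\<exists>E\<in>components G T. D \<subseteq> E \<and> E \<subseteq> C"
proof -
  obtain v where v: "v \<in> verts G" "D = component G S v" using D by (auto simp: components_def)
  then have "v \<in> C" using D component_self by blast
  then have "C = component G U v" using components_component C by blast
  then have "D \<subseteq> component G T v" "component G T v \<subseteq> C"
    using v component_mono[OF S(1)] component_mono[OF S(2)] by auto
  then show ?thesis using component_in_components[OF v(1)] by blast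
qed

lemma component_containing:
  assumes "S \<subseteq> T" "D \<in> components G S"
  shows "\<exists>C\<in>components G T. D \<subseteq> C"
proof -
  obtain v where "v \<in> verts G" "D = component G S v" using assms by (auto simp: components_def)
  then show ?thesis
    using component_mono[OF assms(1)] component_in_components by blast
qed

lemma component_insert:
  fixes S :: "'e set"
  assumes e: "ends G e = Upair u w" "u \<in> verts G" "w \<in> verts G" and v: "v \<in> verts G"
  defines "M \<equiv> component G S u \<union> component G S w"
  shows "component G (insert e S) v = (if v \<in> M then M else component G S v)"
proof -
  let ?R = "(adjacency G S)\<^sup>*" and ?T = "(adjacency G (insert e S))\<^sup>*"
  have adj: "adjacency G (insert e S) = insert (u, w) (insert (w, u) (adjacency G S))"
    using e by (auto simp: adjacency_def)
  have up: "?R \<subseteq> ?T" by (intro rtrancl_mono adjacency_mono) auto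
  have uw: "(u, w) \<in> ?T" "(w, u) \<in> ?T" unfolding adj by auto
  have M_iff: "x \<in> M \<longleftrightarrow> x \<in> verts G \<and> ((u, x) \<in> ?R \<or> (w, x) \<in> ?R)" for x
    by (auto simp: M_def component_def)
  have step: "(v, x) \<in> ?R \<or> ((u, v) \<in> ?R \<or> (w, v) \<in> ?R) \<and> ((u, x) \<in> ?R \<or> (w, x) \<in> ?R)"
    if "(v, x) \<in> ?T" for x
    using that
  proof (induction rule: rtrancl_induct)
    case base
    show ?case by simp
  next
    case (step y z)
    consider "y = u" "z = w" | "y = w" "z = u" | "(y, z) \<in> adjacency G S"
      using step.hyps(2) adj by auto
    then show ?case
    proof cases
      case 3
      then show ?thesis using step.IH by (meson rtrancl.rtrancl_into_rtrancl)
    qed (use step.IH adjacency_sym in blast)+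
  qed
  show ?thesis
  proof (cases "v \<in> M")
    case True
    have "(v, x) \<in> ?T" if "x \<in> M" for x
    proof -
      have *: "(u, y) \<in> ?T" if "y \<in> M" for y
        using that up uw unfolding M_iff by (meson rtrancl_trans subsetD)
      show ?thesis using *[OF that] *[OF True] adjacency_sym rtrancl_trans by metis
    qed
    moreover have "x \<in> M" if "(v, x) \<in> ?T" "x \<in> verts G" for x
      using step[OF that(1)] that(2) True unfolding M_iff by (meson rtrancl_trans)
    ultimately show ?thesis using True by (auto simp: component_def M_iff)
  next
    case False
    then have "(v, x) \<in> ?R" if "(v, x) \<in> ?T" for x
      using step[OF that] v unfolding M_iff by blast
    then show ?thesis using False up by (auto simp: component_def)
  qed
qed

lemma components_insert:
  assumes e: "ends G e = Upair u w" "u \<in> verts G" "w \<in> verts G"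
  shows "components G (insert e S) =
    insert (component G S u \<union> component G S w)
      (components G S - {component G S u, component G S w})"
    (is "_ = insert ?M _")
proof -
  have *: "component G (insert e S) v = (if v \<in> ?M then ?M else component G S v)"
    if "v \<in> verts G" for v using component_insert[OF e that] .
  have "?M \<in> components G (insert e S)"
    using *[OF e(2)] component_self[OF e(2)] component_in_components[OF e(2), of "insert e S"] by auto
  moreover have "C \<in> components G (insert e S)"
    if C: "C \<in> components G S - {component G S u, component G S w}" for C
  proof -
    obtain v where v: "v \<in> verts G" "C = component G S v"
      using C unfolding components_def by blast
    then have "v \<notin> ?M" using C component_eq by blast
    then show ?thesis using * v component_in_components by metis
  qed
  moreover have "C \<in> insert ?M (components G S - {component G S u, component G S w})"
    if C: "C \<in> components G (insert e S)" for C
  proof -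
    obtain v where v: "v \<in> verts G" "C = component G (insert e S) v"
      using C by (auto simp: components_def)
    show ?thesis
    proof (cases "v \<in> ?M")
      case False
      then have "component G S v \<noteq> component G S u" "component G S v \<noteq> component G S w"
        using component_self[OF v(1)] by auto
      then show ?thesis using False * v component_in_components by auto
    qed (use * v in auto)
  qed
  ultimately show ?thesis by blast
qed

section \<open>Pushing states to larger subgraphs\<close>

text \<open>The refined enhanced state on the edge set \<open>S\<close> in which exactly the components in \<open>X\<close> have the
  label \<open>x\<close> and exactly the edges in \<open>Y\<close> have the label \<open>y\<close>.\<close>

definition encode :: "'e set \<Rightarrow> 'v set set \<Rightarrow> 'e set \<Rightarrow> ('v, 'e) state" where
  "encode S X Y = State S
     (\<lambda>C. if C \<in> components G S then Some (if C \<in> X then Cx else C1) else None)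
     (\<lambda>e. if e \<in> S then Some (if e \<in> Y then Ey else E1) else None)"

text \<open>The triples \<open>(S, X, Y)\<close> that describe refined enhanced states, each exactly one.\<close>

definition codes :: "('e set \<times> 'v set set \<times> 'e set) set" where
  "codes = (SIGMA S:Pow (edges G). Pow (components G S) \<times> Pow S)"

text \<open>For a set \<open>X\<close> of components of some subgraph, the components of the larger subgraph \<open>T\<close> that
  contain a member of \<open>X\<close>.\<close>

definition push :: "'e set \<Rightarrow> 'v set set \<Rightarrow> 'v set set" where
  "push T X = {C \<in> components G T. \<exists>D\<in>X. D \<subseteq> C}"

text \<open>No two members of \<open>X\<close> are merged in \<open>T\<close>: the product of the labels of the components merged
  into one component of \<open>T\<close> is then nonzero.\<close>

definition separated :: "'e set \<Rightarrow> 'v set set \<Rightarrow> bool" where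
  "separated T X \<longleftrightarrow> (\<forall>C\<in>components G T. \<forall>D\<in>X. \<forall>D'\<in>X. D \<subseteq> C \<longrightarrow> D' \<subseteq> C \<longrightarrow> D = D')"

text \<open>The result of adding all the edges of \<open>T\<close> at once to the state given by \<open>X\<close> and \<open>Y\<close> on a
  smaller edge set: the new edges have the label \<open>1\<close>, labels of merged components are multiplied in
  \<open>\<int>[x]/(x\<^sup>2)\<close>, and the result is \<open>0\<close> if some product vanishes.\<close>

definition push_state :: "'e set \<Rightarrow> 'v set set \<Rightarrow> 'e set \<Rightarrow> ('v, 'e) state \<Rightarrow>\<^sub>0 int" where
  "push_state T X Y = (if separated T X then frag_of (encode T (push T X) Y) else 0)"

lemma state_edges_encode [simp]:
  "state_edges (encode S X Y) = S"
  by (simp add: encode_def)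

lemma codes_iff: "(S, X, Y) \<in> codes \<longleftrightarrow> S \<subseteq> edges G \<and> X \<subseteq> components G S \<and> Y \<subseteq> S"
  by (auto simp: codes_def)

lemma push_subset: "push T X \<subseteq> components G T"
  by (auto simp: push_def)

text \<open>This lemma and the next say that pushing to \<open>T\<close> and then to \<open>U\<close> is pushing to \<open>U\<close>. So adding
  two edges one after the other does not depend on their order.\<close>

lemma separated_push:
  assumes X: "X \<subseteq> components G S" and S: "S \<subseteq> T" "T \<subseteq> U"
  shows "separated T X \<and> separated U (push T X) \<longleftrightarrow> separated U X"
proof (intro iffI conjI)
  assume sep: "separated T X \<and> separated U (push T X)"
  show "separated U X"
    unfolding separated_def
  proof (intro ballI impI)
    fix C D D' assume C: "C \<in> components G U" "D \<in> X" "D' \<in> X" "D \<subseteq> C" "D' \<subseteq> C"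
    have *: "\<exists>E \<in> push T X. D \<subseteq> E \<and> E \<subseteq> C" if "D \<in> X" "D \<subseteq> C" for D
      using intermediate_component[OF S, of D C] that X C(1) by (auto simp: push_def)
    obtain E E' where E: "E \<in> push T X" "D \<subseteq> E" "E \<subseteq> C" "E' \<in> push T X" "D' \<subseteq> E'" "E' \<subseteq> C"
      using * C by metis
    then have "E = E'" using sep C by (auto simp: separated_def)
    moreover have "E \<in> components G T" using E push_subset by blast
    ultimately show "D = D'" using sep C E unfolding separated_def by blast
  qed
next
  assume sep: "separated U X"
  show "separated T X"
    unfolding separated_def
  proof (intro ballI impI)
    fix C D D' assume C: "C \<in> components G T" "D \<in> X" "D' \<in> X" "D \<subseteq> C" "D' \<subseteq> C"
    obtain C' where "C' \<in> components G U" "C \<subseteq> C'"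
      using component_containing[OF S(2) C(1)] by blast
    then show "D = D'" using sep C by (meson separated_def subset_trans)
  qed
  show "separated U (push T X)"
    unfolding separated_def
  proof (intro ballI impI)
    fix C E E' assume C: "C \<in> components G U" "E \<in> push T X" "E' \<in> push T X" "E \<subseteq> C" "E' \<subseteq> C"
    then obtain D D' where D: "D \<in> X" "D \<subseteq> E" "D' \<in> X" "D' \<subseteq> E'" by (auto simp: push_def)
    then have "D = D'" using sep C by (meson separated_def subset_trans)
    then have "D \<subseteq> E" "D \<subseteq> E'" "D \<noteq> {}" using D X components_nonempty by blast+
    moreover have "E \<in> components G T" "E' \<in> components G T" using C push_subset by blast+
    ultimately show "E = E'" using components_eq_if_meet by metis
  qed
qed

lemma push_push:
  assumes X: "X \<subseteq> components G S" and S: "S \<subseteq> T" "T \<subseteq> U"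
  shows "push U (push T X) = push U X"
proof -
  have "C \<in> push U (push T X) \<longleftrightarrow> C \<in> push U X" for C
  proof
    assume "C \<in> push U (push T X)"
    then obtain D E where "C \<in> components G U" "E \<subseteq> C" "D \<in> X" "D \<subseteq> E"
      by (auto simp: push_def)
    then show "C \<in> push U X" unfolding push_def by blast
  next
    assume "C \<in> push U X"
    then obtain D where D: "C \<in> components G U" "D \<in> X" "D \<subseteq> C" by (auto simp: push_def)
    then obtain E where "E \<in> components G T" "D \<subseteq> E" "E \<subseteq> C"
      using intermediate_component[OF S, of D C] X by blast
    then have "E \<in> push T X" "E \<subseteq> C" using D by (auto simp: push_def)
    then show "C \<in> push U (push T X)" using D(1) unfolding push_def[of U] by blast
  qed
  then show ?thesis by blast
qed

text \<open>The number of \<open>x\<close> labels is preserved, so that the differential preserves the degree \<open>j\<close>.\<close>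

lemma card_push:
  assumes X: "X \<subseteq> components G S" and S: "S \<subseteq> T" and sep: "separated T X"
  shows "card (push T X) = card X"
proof -
  have "\<forall>D\<in>X. \<exists>C. C \<in> components G T \<and> D \<subseteq> C"
    using component_containing[OF S] X by blast
  then obtain f where f: "\<And>D. D \<in> X \<Longrightarrow> f D \<in> components G T \<and> D \<subseteq> f D" by metis
  have f_unique: "C = f D" if "D \<in> X" "C \<in> components G T" "D \<subseteq> C" for C D
    using that f[OF that(1)] X components_nonempty components_eq_if_meet by blast
  have "inj_on f X" using sep f by (metis inj_onI separated_def)
  moreover have "f ` X = push T X"
  proof (intro equalityI subsetI)
    fix C assume "C \<in> push T X"
    then obtain D where D: "C \<in> components G T" "D \<in> X" "D \<subseteq> C" by (auto simp: push_def)
    then show "C \<in> f ` X" using f_unique[OF D(2,1,3)] by simp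
  qed (auto simp: push_def dest: f)
  ultimately show ?thesis by (metis card_image)
qed

lemma partial_diff_encode:
  assumes S: "S \<subseteq> edges G" "X \<subseteq> components G S" "Y \<subseteq> S" and e: "e \<in> edges G" "e \<notin> S"
  shows "partial_diff G e (encode S X Y) = push_state (insert e S) X Y"
proof -
  obtain u w where uw: "end_pair G e = (u, w)" "ends G e = Upair u w" "u \<in> verts G" "w \<in> verts G"
    using end_pair_verts[OF e(1)] .
  let ?A = "component G S u" and ?B = "component G S w" and ?T = "insert e S"
  have AB: "?A \<in> components G S" "?B \<in> components G S"
    using uw component_in_components by auto
  note T = components_insert[OF uw(2-4), of S]
  have elab: "(elab (encode S X Y))(e := Some E1) = elab (encode ?T (push ?T X) Y)"
    using e S by (auto simp: encode_def fun_eq_iff)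
  have old: "D = C" if "C \<in> components G S" "D \<in> X" "D \<subseteq> C" for C D
    using that S components_subset_eq by blast
  show ?thesis
  proof (cases "?A = ?B")
    case True
    have T': "components G ?T = components G S" using T True AB by auto
    have "separated ?T X" using old by (auto simp: separated_def T')
    moreover have "push ?T X = X" using old S(2) by (auto simp: push_def T')
    ultimately show ?thesis
      using True elab by (simp add: partial_diff_def uw push_state_def encode_def Let_def T')
  next
    case False
    let ?M = "?A \<union> ?B"
    have in_M: "D = ?A \<or> D = ?B" if "D \<in> X" "D \<subseteq> ?M" for D
    proof -
      have D: "D \<in> components G S" using that S by blast
      then obtain x where "x \<in> D" using components_nonempty by blast
      then show ?thesis using that D AB components_component by (metis UnE subsetD)
    qed
    have neq: "?A \<noteq> ?M" "?B \<noteq> ?M" using False AB components_subset_eq by blast+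
    have lab: "the (clab (encode S X Y) C) = (if C \<in> X then Cx else C1)"
      if "C \<in> components G S" for C using that by (simp add: encode_def)
    show ?thesis
    proof (cases "?A \<in> X \<and> ?B \<in> X")
      case True
      have "?M \<in> components G ?T" by (simp add: T)
      then have "\<not> separated ?T X"
        using True False unfolding separated_def by (metis Un_upper1 Un_upper2)
      then show ?thesis
        using True False lab AB by (simp add: partial_diff_def uw push_state_def Let_def encode_def)
    next
      case notboth: False
      define m where "m = (if ?A \<in> X \<or> ?B \<in> X then Cx else C1)"
      have mult: "label_mult (if ?A \<in> X then Cx else C1) (if ?B \<in> X then Cx else C1) = Some m"
        using notboth by (auto simp: m_def)
      have sep: "separated ?T X"
        unfolding separated_def
      proof (intro ballI impI)
        fix C D D' assume C: "C \<in> components G ?T" "D \<in> X" "D' \<in> X" "D \<subseteq> C" "D' \<subseteq> C"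
        show "D = D'"
        proof (cases "C = ?M")
          case True
          then show ?thesis using in_M[of D] in_M[of D'] C notboth by auto
        next
          case False
          then show ?thesis using old[of C D] old[of C D'] C T by auto
        qed
      qed
      have "((clab (encode S X Y))(?A := None, ?B := None, ?M := Some m)) C
          = clab (encode ?T (push ?T X) Y) C" for C
      proof -
        consider "C = ?M" | "C \<noteq> ?M" "C = ?A \<or> C = ?B"
          | "C \<noteq> ?M" "C \<noteq> ?A" "C \<noteq> ?B" by blast
        then show ?thesis
        proof cases
          case 1
          have "?M \<in> push ?T X \<longleftrightarrow> ?A \<in> X \<or> ?B \<in> X"
            using in_M by (auto simp: push_def T)
          then show ?thesis using 1 by (simp add: encode_def m_def T)
        next
          case 2
          \<comment> \<open>The two components that the edge joins are no longer components.\<close>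
          then have "C \<notin> components G ?T" unfolding T by blast
          then show ?thesis using 2 by (auto simp: encode_def)
        next
          case 3
          have "C \<in> push ?T X \<longleftrightarrow> C \<in> X" if "C \<in> components G S"
            using 3 that old[OF that] by (auto simp: push_def T)
          moreover have "C \<in> components G ?T \<longleftrightarrow> C \<in> components G S" unfolding T using 3 by blast
          ultimately show ?thesis using 3 by (simp add: encode_def)
        qed
      qed
      then have "(clab (encode S X Y))(?A := None, ?B := None, ?M := Some m)
          = clab (encode ?T (push ?T X) Y)" by (rule ext)
      then have "State ?T ((clab (encode S X Y))(?A := None, ?B := None, ?M := Some m))
          ((elab (encode S X Y))(e := Some E1)) = encode ?T (push ?T X) Y"
        using elab by (intro state.expand) simp
      moreover have "label_mult (the (clab (encode S X Y) ?A)) (the (clab (encode S X Y) ?B)) = Some m"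
        using mult lab[OF AB(1)] lab[OF AB(2)] by simp
      ultimately show ?thesis
        using False sep by (simp add: partial_diff_def uw push_state_def Let_def)
    qed
  qed
qed

lemma num_x_encode: "X \<subseteq> components G S \<Longrightarrow> num_x (encode S X Y) = card X"
  unfolding num_x_def encode_def by (rule arg_cong[of _ _ card]) (auto split: if_splits)

lemma num_y_encode: "Y \<subseteq> S \<Longrightarrow> num_y (encode S X Y) = card Y"
  unfolding num_y_def encode_def by (rule arg_cong[of _ _ card]) (auto split: if_splits)

lemma inj_on_encode: "inj_on (\<lambda>(S, X, Y). encode S X Y) codes"
proof (rule inj_onI)
  have dec: "X = {C. clab (encode S X Y) C = Some Cx}" "Y = {e. elab (encode S X Y) e = Some Ey}"
    if "(S, X, Y) \<in> codes" for S X Y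
    using that by (auto simp: encode_def codes_iff split: if_splits)
  fix p q
  assume pq: "p \<in> codes" "q \<in> codes"
    "(\<lambda>(S, X, Y). encode S X Y) p = (\<lambda>(S, X, Y). encode S X Y) q"
  obtain S X Y S' X' Y' where p: "p = (S, X, Y)" and q: "q = (S', X', Y')"
    by (metis prod_cases3)
  have eq: "encode S X Y = encode S' X' Y'" using pq p q by simp
  have "S = S'" using arg_cong[OF eq, of state_edges] by simp
  then show "p = q" using dec[of S X Y] dec[of S' X' Y'] pq p q eq by simp
qed

lemma refined_states_eq: "refined_states G = (\<lambda>(S, X, Y). encode S X Y) ` codes"
proof (intro equalityI subsetI)
  fix s assume s: "s \<in> refined_states G"
  let ?S = "state_edges s" and ?X = "{C. clab s C = Some Cx}" and ?Y = "{e. elab s e = Some Ey}"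
  have dom: "dom (clab s) = components G ?S" "dom (elab s) = ?S" "?S \<subseteq> edges G"
    using s by (auto simp: refined_states_def)
  have l: "l \<noteq> None \<Longrightarrow> l \<noteq> Some Cx \<Longrightarrow> l = Some C1" for l
    by (metis comp_label.exhaust option.exhaust)
  have m: "l \<noteq> None \<Longrightarrow> l \<noteq> Some Ey \<Longrightarrow> l = Some E1" for l
    by (metis edge_label.exhaust option.exhaust)
  have "s = encode ?S ?X ?Y"
  proof (rule state.expand, intro conjI)
    show "clab s = clab (encode ?S ?X ?Y)"
      using dom(1) l by (fastforce simp: encode_def fun_eq_iff domIff set_eq_iff)
    show "elab s = elab (encode ?S ?X ?Y)"
      using dom(2) m by (fastforce simp: encode_def fun_eq_iff domIff set_eq_iff)
  qed simp
  moreover have "(?S, ?X, ?Y) \<in> codes" using dom by (auto simp: codes_iff)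
  ultimately show "s \<in> (\<lambda>(S, X, Y). encode S X Y) ` codes" by force
next
  fix s assume "s \<in> (\<lambda>(S, X, Y). encode S X Y) ` codes"
  then obtain S X Y where s: "(S, X, Y) \<in> codes" "s = encode S X Y" by auto
  have "dom (clab s) = components G S" "dom (elab s) = S"
    unfolding s by (auto simp: encode_def split: if_splits)
  then show "s \<in> refined_states G" using s by (simp add: refined_states_def codes_iff)
qed

lemma finite_refined_states: "finite (refined_states G)"
proof -
  have *: "finite (Pow (components G S) \<times> Pow S)" if "S \<in> Pow (edges G)" for S
    using that finite_components finite_subgraph by simp
  then have "finite codes"
    unfolding codes_def using finite_edges by (intro finite_SigmaI[OF _ *]) simp_all
  then show ?thesis unfolding refined_states_eq by (rule finite_imageI)
qed

end

section \<open>The square of the differential\<close>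

lemma sum_antisymmetric_offdiagonal:
  fixes g :: "'e \<Rightarrow> 'e \<Rightarrow> 'a \<Rightarrow>\<^sub>0 int"
  assumes "finite A" "\<And>e f. e \<in> A \<Longrightarrow> f \<in> A \<Longrightarrow> e \<noteq> f \<Longrightarrow> g e f = - g f e"
  shows "(\<Sum>e\<in>A. \<Sum>f\<in>A - {e}. g e f) = 0"
proof -
  define h where "h e f = (if e = f then 0 else g e f)" for e f
  have h: "h e f = - h f e" if "e \<in> A" "f \<in> A" for e f
    using assms(2)[OF that] by (auto simp: h_def)
  have "(\<Sum>e\<in>A. \<Sum>f\<in>A - {e}. g e f) = (\<Sum>e\<in>A. \<Sum>f\<in>A. h e f)" (is "?s = ?t")
    using assms(1) by (intro sum.cong sum.mono_neutral_cong_left) (auto simp: h_def)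
  moreover have "?t = - ?t"
  proof -
    have "?t = (\<Sum>f\<in>A. \<Sum>e\<in>A. h e f)" by (rule sum.swap)
    also have "\<dots> = (\<Sum>f\<in>A. \<Sum>e\<in>A. - h f e)"
      by (intro sum.cong refl) (rule h)
    finally show ?thesis by (simp add: sum_negf)
  qed
  moreover have "x = 0" if "x = - x" for x :: "'a \<Rightarrow>\<^sub>0 int"
  proof (rule poly_mapping_eqI)
    fix k
    have "poly_mapping.lookup x k = - poly_mapping.lookup x k"
      using arg_cong[OF that, of "\<lambda>y. poly_mapping.lookup y k"] by simp
    then show "poly_mapping.lookup x k = poly_mapping.lookup 0 k" by simp
  qed
  ultimately show ?thesis by metis
qed

text \<open>The sign with which the edge \<open>e\<close> is added to a state with edge set \<open>S\<close>.\<close>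

definition edge_sign :: "'e rel \<Rightarrow> 'e set \<Rightarrow> 'e \<Rightarrow> int" where
  "edge_sign r S e = (- 1) ^ card {e' \<in> S. e' \<noteq> e \<and> (e', e) \<in> r}"

lemma edge_sign_insert:
  assumes "finite S" "e \<notin> S" "e \<noteq> f"
  shows "edge_sign r (insert e S) f = (if (e, f) \<in> r then - 1 else 1) * edge_sign r S f"
proof -
  have "{e' \<in> insert e S. e' \<noteq> f \<and> (e', f) \<in> r} =
      (if (e, f) \<in> r then insert e {e' \<in> S. e' \<noteq> f \<and> (e', f) \<in> r}
       else {e' \<in> S. e' \<noteq> f \<and> (e', f) \<in> r})"
    using assms by auto
  then show ?thesis using assms by (simp add: edge_sign_def)
qed

lemma module_hom_differential: "module_hom frag_cmul frag_cmul (differential G r)"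
  by unfold_locales (simp_all add: differential_def frag_extend_add frag_extend_cmul)

lemmas differential_sum = module_hom.sum[OF module_hom_differential]
lemmas differential_scale = module_hom.scale[OF module_hom_differential]

lemma carrier_chain_gp: "carrier (chain_gp G k i j) = {x. Poly_Mapping.keys x \<subseteq> graded_states G k i j}"
  by (auto simp: chain_gp_def)

lemma cycles_eq: "cycles G r k i j = {x \<in> carrier (chain_gp G k i j). differential G r x = 0}"
  by (auto simp: cycles_def kernel_def chain_gp_def)

context fin_graph
begin

lemma state_diff_encode:
  assumes "(S, X, Y) \<in> codes"
  shows "state_diff G r (encode S X Y) =
    (\<Sum>e\<in>edges G - S. frag_cmul (edge_sign r S e) (push_state (insert e S) X Y))"
  unfolding state_diff_def using assms partial_diff_encode
  by (auto simp: codes_iff num_preceding_def edge_sign_def intro!: sum.cong)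

lemma push_codes:
  assumes "(S, X, Y) \<in> codes" "S \<subseteq> T" "T \<subseteq> edges G"
  shows "(T, push T X, Y) \<in> codes"
  using assms push_subset by (auto simp: codes_iff)

lemma push_state_push:
  assumes "X \<subseteq> components G S" "S \<subseteq> T" "T \<subseteq> U" "separated T X"
  shows "push_state U (push T X) Y = push_state U X Y"
  using separated_push[OF assms(1-3)] push_push[OF assms(1-3)] assms(4)
  by (simp add: push_state_def)

lemma differential_push_state:
  assumes c: "(S, X, Y) \<in> codes" and T: "S \<subseteq> T" "T \<subseteq> edges G"
  shows "differential G r (push_state T X Y) =
    (\<Sum>f\<in>edges G - T. frag_cmul (edge_sign r T f) (push_state (insert f T) X Y))"
proof (cases "separated T X")
  case True
  then have "differential G r (push_state T X Y) = state_diff G r (encode T (push T X) Y)"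
    by (simp add: push_state_def differential_def)
  also have "\<dots> = (\<Sum>f\<in>edges G - T. frag_cmul (edge_sign r T f) (push_state (insert f T) (push T X) Y))"
    by (rule state_diff_encode[OF push_codes[OF c T]])
  also have "\<dots> = (\<Sum>f\<in>edges G - T. frag_cmul (edge_sign r T f) (push_state (insert f T) X Y))"
  proof (rule sum.cong[OF refl])
    fix f
    have "push_state (insert f T) (push T X) Y = push_state (insert f T) X Y"
      using c T True by (intro push_state_push[of X S]) (auto simp: codes_iff)
    then show "frag_cmul (edge_sign r T f) (push_state (insert f T) (push T X) Y)
        = frag_cmul (edge_sign r T f) (push_state (insert f T) X Y)" by simp
  qed
  finally show ?thesis .
next
  case False
  have "X \<subseteq> components G S" using c by (simp add: codes_iff)
  then have "push_state (insert f T) X Y = 0" for f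
    using separated_push[of X S T "insert f T"] False T by (auto simp: push_state_def)
  then show ?thesis using False by (simp add: push_state_def differential_def)
qed

text \<open>The square of the differential is a sum over ordered pairs \<open>(e, f)\<close> of added edges. The chain for
  \<open>(e, f)\<close> is symmetric in \<open>e\<close> and \<open>f\<close>, and the sign is antisymmetric, since exactly one of the two
  edges precedes the other.\<close>

lemma differential_state_diff:
  assumes r: "linear_order_on (edges G) r" and s: "s \<in> refined_states G"
  shows "differential G r (state_diff G r s) = 0"
proof -
  obtain S X Y where c: "(S, X, Y) \<in> codes" and s: "s = encode S X Y"
    using s by (auto simp: refined_states_eq)
  then have S: "S \<subseteq> edges G" "finite S" using finite_subgraph by (auto simp: codes_iff)
  define g where "g e f = frag_cmul (edge_sign r S e * edge_sign r (insert e S) f)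
    (push_state (insert f (insert e S)) X Y)" for e f
  have "differential G r (state_diff G r s)
     = (\<Sum>e\<in>edges G - S. frag_cmul (edge_sign r S e) (differential G r (push_state (insert e S) X Y)))"
    by (simp add: s state_diff_encode[OF c] differential_sum differential_scale)
  also have "\<dots> = (\<Sum>e\<in>edges G - S. \<Sum>f\<in>edges G - S - {e}. g e f)"
  proof (rule sum.cong[OF refl])
    fix e assume "e \<in> edges G - S"
    then have "differential G r (push_state (insert e S) X Y) =
      (\<Sum>f\<in>edges G - insert e S. frag_cmul (edge_sign r (insert e S) f) (push_state (insert f (insert e S)) X Y))"
      using S by (intro differential_push_state[OF c]) auto
    moreover have "edges G - insert e S = edges G - S - {e}" by blast
    ultimately show "frag_cmul (edge_sign r S e) (differential G r (push_state (insert e S) X Y))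
        = (\<Sum>f\<in>edges G - S - {e}. g e f)"
      by (simp add: g_def frag_cmul_sum)
  qed
  also have "\<dots> = 0"
  proof (rule sum_antisymmetric_offdiagonal)
    fix e f assume ef: "e \<in> edges G - S" "f \<in> edges G - S" "e \<noteq> f"
    have "(e, f) \<in> r \<longleftrightarrow> (f, e) \<notin> r"
      using r ef unfolding linear_order_on_def partial_order_on_def
      by (meson DiffD1 antisymD total_on_def)
    then have "edge_sign r S e * edge_sign r (insert e S) f = - (edge_sign r S f * edge_sign r (insert f S) e)"
      using ef S edge_sign_insert[of S e f r] edge_sign_insert[of S f e r] by auto
    then show "g e f = - g f e"
      unfolding g_def insert_commute[of f e] minus_frag_cmul by (rule arg_cong)
  qed (use finite_edges in simp)
  finally show ?thesis .
qed

lemma encode_graded_iff: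
  assumes "(S, X, Y) \<in> codes"
  shows "encode S X Y \<in> graded_states G k i j \<longleftrightarrow> card S = k \<and> card Y = i \<and> card X = j"
proof -
  have "encode S X Y \<in> refined_states G" using assms by (force simp: refined_states_eq)
  then show ?thesis
    using assms by (simp add: graded_states_def num_x_encode num_y_encode codes_iff)
qed

lemma finite_graded_states: "finite (graded_states G k i j)"
  using finite_refined_states by (auto simp: graded_states_def)

lemma keys_state_diff:
  assumes "s \<in> graded_states G k i j"
  shows "Poly_Mapping.keys (state_diff G r s) \<subseteq> graded_states G (Suc k) i j"
proof -
  obtain S X Y where c: "(S, X, Y) \<in> codes" and s: "s = encode S X Y"
    using assms by (auto simp: refined_states_eq graded_states_def)
  have "Poly_Mapping.keys (push_state (insert e S) X Y) \<subseteq> graded_states G (Suc k) i j"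
    if e: "e \<in> edges G - S" for e
  proof (cases "separated (insert e S) X")
    case True
    have "(insert e S, push (insert e S) X, Y) \<in> codes"
      using e c by (intro push_codes) (auto simp: codes_iff)
    moreover have "card (push (insert e S) X) = card X"
      using c True by (intro card_push[of X S]) (auto simp: codes_iff)
    moreover have "card (insert e S) = Suc (card S)"
      using e c finite_subgraph by (simp add: codes_iff)
    ultimately have "encode (insert e S) (push (insert e S) X) Y \<in> graded_states G (Suc k) i j"
      using assms s encode_graded_iff[OF c] encode_graded_iff by metis
    then show ?thesis using True by (simp add: push_state_def)
  qed (simp add: push_state_def)
  then show ?thesis
    unfolding s state_diff_encode[OF c]
    by (intro order_trans[OF keys_sum] UN_least order_trans[OF keys_cmul])
qed

lemma differential_in_chains:
  assumes "x \<in> carrier (chain_gp G k i j)"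
  shows "differential G r x \<in> carrier (chain_gp G (Suc k) i j)"
proof -
  have "(\<Union>s\<in>Poly_Mapping.keys x. Poly_Mapping.keys (state_diff G r s))
      \<subseteq> graded_states G (Suc k) i j"
    using assms by (intro UN_least keys_state_diff) (auto simp: carrier_chain_gp)
  then show ?thesis
    using keys_frag_extend[of "state_diff G r" x]
    unfolding differential_def carrier_chain_gp mem_Collect_eq by (rule order_trans[rotated])
qed

lemma differential_differential:
  assumes "linear_order_on (edges G) r" "x \<in> carrier (chain_gp G k i j)"
  shows "differential G r (differential G r x) = 0"
proof -
  have "differential G r (differential G r x) =
      (\<Sum>s\<in>Poly_Mapping.keys x. frag_cmul (poly_mapping.lookup x s) (differential G r (state_diff G r s)))"
    unfolding differential_def[of G r] frag_extend_def[of "state_diff G r" x]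
    by (simp add: frag_extend_sum frag_extend_cmul)
  also have "\<dots> = 0"
    using differential_state_diff[OF assms(1)] assms(2)
    by (intro sum.neutral) (auto simp: carrier_chain_gp graded_states_def)
  finally show ?thesis .
qed

end

section \<open>The Euler characteristic of the homology\<close>

lemma alternating_sum_telescope:
  fixes b c z :: "nat \<Rightarrow> int"
  assumes "\<And>k. c k = z k + b (Suc k)" "b 0 = 0"
  shows "(\<Sum>k\<le>n. (- 1) ^ k * (z k - b k)) = (\<Sum>k\<le>n. (- 1) ^ k * c k) - (- 1) ^ n * b (Suc n)"
  by (induction n) (simp_all add: assms algebra_simps)

context fin_graph
begin

lemma subspace_chains: "frag.subspace (carrier (chain_gp G k i j))"
  unfolding chain_gp_def by (rule subspace_carrier_free_Abelian_group)

lemma chains_finitely_spanned: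
  "finite (frag_of ` graded_states G k i j)"
  "carrier (chain_gp G k i j) \<subseteq> frag.span (frag_of ` graded_states G k i j)"
  by (simp_all add: finite_graded_states span_frag_of chain_gp_def)

lemma rank_chains: "frag.rank (carrier (chain_gp G k i j)) = card (graded_states G k i j)"
  unfolding chain_gp_def by (rule rank_free_Abelian_group[OF finite_graded_states])

lemma rank_chains_eq:
  "card (graded_states G k i j) =
     frag.rank (cycles G r k i j) + frag.rank (boundaries G r (Suc k) i j)"
proof -
  have "frag.rank (carrier (chain_gp G k i j)) = frag.rank (cycles G r k i j) +
      frag.rank (differential G r ` carrier (chain_gp G k i j))"
    unfolding cycles_eq
    by (rule frag.rank_kernel_image[OF module_hom_differential subspace_chains chains_finitely_spanned])
  then show ?thesis unfolding rank_chains by (simp only: boundaries_def nat.case)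
qed

lemma subspace_cycles: "frag.subspace (cycles G r k i j)"
proof -
  have "cycles G r k i j = carrier (chain_gp G k i j) \<inter> {x. differential G r x = 0}"
    by (auto simp: cycles_eq)
  then show ?thesis using frag.subspace_inter[OF subspace_chains module_hom.subspace_kernel[OF module_hom_differential]] by simp
qed

lemma subspace_boundaries: "frag.subspace (boundaries G r k i j)"
proof -
  show ?thesis
    using module_hom.subspace_image[OF module_hom_differential subspace_chains] by (simp add: boundaries_def split: nat.split)
qed

lemma boundaries_subset_cycles:
  assumes "linear_order_on (edges G) r"
  shows "boundaries G r k i j \<subseteq> cycles G r k i j"
proof -
  show ?thesis
    using differential_differential[OF assms] differential_in_chains frag.subspace_0[OF subspace_cycles]
    by (auto simp: boundaries_def cycles_eq split: nat.split)
qed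

lemma abelian_rank_homology:
  assumes "linear_order_on (edges G) r"
  shows "int (abelian_rank (homology G r k i j)) =
    int (frag.rank (cycles G r k i j)) - int (frag.rank (boundaries G r k i j))"
proof -
  have Z: "cycles G r k i j \<subseteq> carrier (chain_gp G k i j)" by (auto simp: cycles_eq)
  have "frag.rank (boundaries G r k i j) \<le> frag.rank (cycles G r k i j)"
    using boundaries_subset_cycles[OF assms] chains_finitely_spanned(1)
      order_trans[OF Z chains_finitely_spanned(2)] by (rule frag.rank_mono)
  moreover have "abelian_rank (homology G r k i j) =
      frag.rank (cycles G r k i j) - frag.rank (boundaries G r k i j)"
    unfolding homology_def chain_gp_def
    using Z by (intro abelian_rank_quotient finite_graded_states subspace_cycles
        subspace_boundaries boundaries_subset_cycles[OF assms]) (simp add: chain_gp_def)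
  ultimately show ?thesis by simp
qed

lemma graded_states_empty: "card (edges G) < k \<Longrightarrow> graded_states G k i j = {}"
proof (rule ccontr)
  assume k: "card (edges G) < k" and "graded_states G k i j \<noteq> {}"
  then obtain s where "s \<in> graded_states G k i j" by blast
  then have "state_edges s \<subseteq> edges G" "card (state_edges s) = k"
    by (simp_all add: graded_states_def refined_states_def)
  then show False using card_mono[OF finite_edges, of "state_edges s"] k by simp
qed

lemma homology_euler_eq:
  assumes r: "linear_order_on (edges G) r"
  shows "homology_euler G r i j =
    (\<Sum>k\<le>card (edges G). (- 1) ^ k * int (card (graded_states G k i j)))"
proof -
  let ?n = "card (edges G)"
  define z where "z k = int (frag.rank (cycles G r k i j))" for k
  define b where "b k = int (frag.rank (boundaries G r k i j))" for k
  have c: "int (card (graded_states G k i j)) = z k + b (Suc k)" for k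
    using rank_chains_eq[of k i j r] by (simp add: z_def b_def)
  have h: "int (abelian_rank (homology G r k i j)) = z k - b k" for k
    using abelian_rank_homology[OF r] by (simp add: z_def b_def)
  \<comment> \<open>There are no chains in degree \<open>-1\<close>, and none above the number of edges, so both ends of the
    telescoping sum vanish.\<close>
  have b0: "b 0 = 0"
    using frag.rank_span[of "{}"] frag.independent_empty by (simp add: b_def boundaries_def)
  have pos: "z k \<ge> 0" "b k \<ge> 0" "z k - b k \<ge> 0" for k
    unfolding h[symmetric] by (simp_all add: z_def b_def)
  have z_vanish: "z k = 0" if "k > ?n" for k
    using c[of k] pos[of k] pos[of "Suc k"] graded_states_empty[OF that, of i j] by simp
  have b_vanish: "b k = 0" if "k > ?n" for k
    using z_vanish[OF that] pos[of k] by simp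
  have "homology_euler G r i j = (\<Sum>k\<le>?n. (- 1) ^ k * (z k - b k))"
    unfolding homology_euler_def h
  proof (rule Sum_any.expand_superset)
    have "(- 1) ^ k * (z k - b k) = 0" if "k \<notin> {..?n}" for k
      using that z_vanish[of k] b_vanish[of k] by simp
    then show "{k. (- 1) ^ k * (z k - b k) \<noteq> 0} \<subseteq> {..?n}" by blast
  qed simp
  also have "\<dots> = (\<Sum>k\<le>?n. (- 1) ^ k * int (card (graded_states G k i j)))"
    using alternating_sum_telescope[of "\<lambda>k. int (card (graded_states G k i j))" z b ?n] c b0
      b_vanish[of "Suc ?n"] by simp
  finally show ?thesis .
qed

lemma homology_euler_eq_sum_states:
  assumes "linear_order_on (edges G) r"
  shows "homology_euler G r i j =
    (\<Sum>s | s \<in> refined_states G \<and> (num_y s, num_x s) = (i, j). (- 1) ^ card (state_edges s))"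
proof -
  let ?R = "{s \<in> refined_states G. (num_y s, num_x s) = (i, j)}"
  have "card (state_edges s) \<le> card (edges G)" if "s \<in> ?R" for s
    using that card_mono[OF finite_edges] by (auto simp: refined_states_def)
  then have "(\<Sum>s\<in>?R. (- 1) ^ card (state_edges s)) =
     (\<Sum>k\<le>card (edges G). \<Sum>s | s \<in> ?R \<and> card (state_edges s) = k. (- 1) ^ card (state_edges s) :: int)"
    using finite_refined_states by (intro sum.group[symmetric]) auto
  also have "\<dots> = (\<Sum>k\<le>card (edges G). (- 1) ^ k * int (card (graded_states G k i j)))"
  proof (rule sum.cong[OF refl])
    fix k
    have "{s \<in> ?R. card (state_edges s) = k} = graded_states G k i j"
      by (auto simp: graded_states_def)
    then show "(\<Sum>s | s \<in> ?R \<and> card (state_edges s) = k. (- 1) ^ card (state_edges s)) =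
        (- 1) ^ k * int (card (graded_states G k i j))"
      by (simp add: mult.commute flip: sum_constant) (simp add: graded_states_def)
  qed
  finally show ?thesis using homology_euler_eq[OF assms] by simp
qed

end

section \<open>The state expansion of the dichromatic polynomial\<close>

lemma sum_power_card_Pow:
  fixes x :: "'a::comm_ring_1"
  assumes "finite A"
  shows "(\<Sum>B\<in>Pow A. x ^ card B) = (1 + x) ^ card A"
proof -
  have "(1 + x) ^ card A = (\<Prod>_\<in>A. x + 1)" by (simp add: add.commute)
  also have "\<dots> = (\<Sum>B\<in>Pow A. (\<Prod>_\<in>B. x) * (\<Prod>_\<in>A - B. 1))"
    by (rule prod_add[OF assms])
  finally show ?thesis by simp
qed

context fin_graph
begin

lemma dichromatic_eq_sum_states:
  fixes p q :: "'a::comm_ring_1"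
  shows "dichromatic G (1 + p) (1 + q) =
    (\<Sum>s\<in>refined_states G. (- 1) ^ card (state_edges s) * p ^ num_y s * q ^ num_x s)"
proof -
  have "(\<Sum>s\<in>refined_states G. (- 1) ^ card (state_edges s) * p ^ num_y s * q ^ num_x s)
     = (\<Sum>(S, X, Y)\<in>codes. (- 1) ^ card S * p ^ card Y * q ^ card X)"
    unfolding refined_states_eq
    by (subst sum.reindex[OF inj_on_encode])
      (auto intro!: sum.cong simp: codes_iff num_x_encode num_y_encode)
  also have "\<dots> = (\<Sum>S\<in>Pow (edges G). \<Sum>(X, Y)\<in>Pow (components G S) \<times> Pow S.
      (- 1) ^ card S * p ^ card Y * q ^ card X)"
    unfolding codes_def using finite_edges finite_components finite_subgraph
    by (subst sum.Sigma) auto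
  also have "\<dots> = dichromatic G (1 + p) (1 + q)"
    unfolding dichromatic_def
  proof (rule sum.cong[OF refl])
    fix S assume "S \<in> Pow (edges G)"
    then have "finite S" using finite_subgraph by simp
    have "(\<Sum>(X, Y)\<in>Pow (components G S) \<times> Pow S. (- 1) ^ card S * p ^ card Y * q ^ card X)
      = (- 1) ^ card S * ((\<Sum>Y\<in>Pow S. p ^ card Y) * (\<Sum>X\<in>Pow (components G S). q ^ card X))"
      unfolding sum.cartesian_product[symmetric] sum_product
      by (subst sum.swap) (simp add: sum_distrib_left mult.assoc)
    then show "(\<Sum>(X, Y)\<in>Pow (components G S) \<times> Pow S. (- 1) ^ card S * p ^ card Y * q ^ card X)
      = (- 1) ^ card S * (1 + p) ^ card S * (1 + q) ^ card (components G S)"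
      using \<open>finite S\<close> finite_components by (simp add: sum_power_card_Pow mult.assoc)
  qed
  finally show ?thesis by simp
qed

end

theorem mainTheorem1:
  fixes G :: "('v, 'e) multigraph"
    and r :: "'e rel"
  assumes "finite_multigraph G"
    and "linear_order_on (edges G) r"
  shows "dichromatic_pq G =
    Sum_any (\<lambda>(i, j). var_p ^ i * var_q ^ j * of_int (homology_euler G r i j))"
proof -
  interpret fin_graph G by unfold_locales (rule assms(1))
  let ?R = "refined_states G"
  \<comment> \<open>Both sides are the sum of the weights \<open>w s\<close> over all states, the right side grouped by the
    bidegree \<open>\<delta> s = (i, j)\<close>.\<close>
  define \<delta> where "\<delta> s = (num_y s, num_x s)" for s :: "('v, 'e) state"
  define w where "w s = (- 1) ^ card (state_edges s) * var_p ^ num_y s * var_q ^ num_x s"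
    for s :: "('v, 'e) state"
  have summand: "(case d of (i, j) \<Rightarrow> var_p ^ i * var_q ^ j * of_int (homology_euler G r i j))
      = (\<Sum>s | s \<in> ?R \<and> \<delta> s = d. w s)" for d
  proof (cases d)
    case (Pair i j)
    have "(of_int (homology_euler G r i j) :: int poly poly) = (\<Sum>s | s \<in> ?R \<and> \<delta> s = d. (- 1) ^ card (state_edges s))"
      unfolding homology_euler_eq_sum_states[OF assms(2)] by (simp add: \<delta>_def Pair)
    then have "var_p ^ i * var_q ^ j * of_int (homology_euler G r i j)
        = var_p ^ i * var_q ^ j * (\<Sum>s | s \<in> ?R \<and> \<delta> s = d. (- 1) ^ card (state_edges s))"
      by simp
    also have "\<dots> = (\<Sum>s | s \<in> ?R \<and> \<delta> s = d. var_p ^ i * var_q ^ j * (- 1) ^ card (state_edges s))"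
      by (rule sum_distrib_left)
    also have "\<dots> = (\<Sum>s | s \<in> ?R \<and> \<delta> s = d. w s)"
      by (intro sum.cong) (auto simp: w_def \<delta>_def Pair algebra_simps)
    finally show ?thesis by (simp add: Pair)
  qed
  have "Sum_any (\<lambda>(i, j). var_p ^ i * var_q ^ j * of_int (homology_euler G r i j))
      = Sum_any (\<lambda>d. \<Sum>s | s \<in> ?R \<and> \<delta> s = d. w s)"
    by (rule Sum_any.cong) (rule summand)
  also have "\<dots> = (\<Sum>d\<in>\<delta> ` ?R. \<Sum>s | s \<in> ?R \<and> \<delta> s = d. w s)"
  proof (rule Sum_any.expand_superset)
    have "(\<Sum>s | s \<in> ?R \<and> \<delta> s = d. w s) = 0" if "d \<notin> \<delta> ` ?R" for d
      using that by (intro sum.neutral) auto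
    then show "{d. (\<Sum>s | s \<in> ?R \<and> \<delta> s = d. w s) \<noteq> 0} \<subseteq> \<delta> ` ?R" by blast
  qed (use finite_refined_states in simp)
  also have "\<dots> = (\<Sum>s\<in>?R. w s)"
    using finite_refined_states by (intro sum.group) auto
  also have "\<dots> = dichromatic_pq G"
    unfolding dichromatic_pq_def dichromatic_eq_sum_states by (simp add: w_def)
  finally show ?thesis by simp
qed

end
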